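(* Let $\Omega$ be an infinite set and let $\Gamma\le\mathrm{Sym}(\Omega)$ satisfy: (i) the orbits of $\Gamma$ are exactly $\Omega_1,\ldots,\Omega_k$, with each of these being infinite and $\bigcup_{i\le k}\Omega_i=\Omega$ (hence $\Gamma\le\mathrm{Sym}(\Omega_1)\times\cdots\times\mathrm{Sym}(\Omega_k)$, a subgroup of $\mathrm{Sym}(\Omega)$); (ii) there exists $\gamma\in\Gamma$ which is finitary and whose support meets every orbit $\Omega_1,\ldots,\Omega_k$; (iii) the action of $\Gamma$ on $\Omega$ is strongly orbit primitive. Then $\Gamma\ge\bigoplus_{i=1}^k\mathrm{Alt}(\Omega_i)$.
   Context: $\mathrm{Sym}(X)$ is the group of all permutations of a set $X$ (acting on the right). The support of $g$ is $\{x: xg\neq x\}$; $g$ is finitary if its support is finite. $\mathrm{Alt}(X)$ is the group of even finitary permutations of $X$; $\mathrm{Alt}(\Omega_i)$ is regarded as a subgroup of $\mathrm{Sym}(\Omega)$ acting trivially outside $\Omega_i$. For a group $\Gamma$ acting on a set $S$, a $\Gamma$-partition is a partition $\mathcal P$ of $S$ with $Pg\in\mathcal P$ for all $P\in\mathcal P$, $g\in\Gamma$. The action is strongly orbit primitive if for every $\Gamma$-partition of $S$, every part is either a singleton or contains an entire $\Gamma$-orbit. *)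

theory Defs
  imports
    "HOL-Combinatorics.Permutations"
    "HOL-Library.Disjoint_Sets"
    "HOL-Algebra.Group_Action"
    "HOL-Algebra.Product_Groups"
begin

section \<open>Symmetric and alternating groups on a set\<close>

text \<open>
  An element of \<open>Sym(X)\<close> is represented by a total function that is the identity outside \<open>X\<close>, so
  that \<open>Sym(Y) \<subseteq> Sym(X)\<close> holds literally for \<open>Y \<subseteq> X\<close>.  Permutations act on the right, i.e. the
  image \<open>x g\<close> is \<open>g x\<close> and the product \<open>g h\<close> is ``first \<open>g\<close>, then \<open>h\<close>''.
\<close>

definition symmetric_group :: "'a set \<Rightarrow> ('a \<Rightarrow> 'a) monoid"
  where "symmetric_group X = \<lparr>carrier = {p. p permutes X}, mult = (\<lambda>g h. h \<circ> g), one = id\<rparr>"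

definition supp :: "('a \<Rightarrow> 'a) \<Rightarrow> 'a set"
  where "supp g = {x. g x \<noteq> x}"

definition finitary :: "('a \<Rightarrow> 'a) \<Rightarrow> bool"
  where "finitary g \<longleftrightarrow> finite (supp g)"

text \<open>The constant \<^const>\<open>evenperm\<close> is meaningful only for finitary permutations.\<close>

definition alternating_group :: "'a set \<Rightarrow> ('a \<Rightarrow> 'a) monoid"
  where "alternating_group X =
    (symmetric_group X)\<lparr>carrier := {p. p permutes X \<and> finitary p \<and> evenperm p}\<rparr>"

text \<open>
  For a disjoint family of sets \<open>X i\<close>, the direct sum of the groups \<open>Alt(X i)\<close> as a subgroup of
  the symmetric group on the union: a tuple \<open>x\<close> in the direct sum acts on each \<open>X i\<close> as its
  component \<open>x i\<close>.
\<close>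

definition alternating_direct_sum :: "'i set \<Rightarrow> ('i \<Rightarrow> 'a set) \<Rightarrow> ('a \<Rightarrow> 'a) set"
  where "alternating_direct_sum I X =
    {g. g permutes (\<Union>i\<in>I. X i) \<and>
        (\<exists>x \<in> carrier (sum_group I (\<lambda>i. alternating_group (X i))). \<forall>i\<in>I. \<forall>w\<in>X i. g w = x i w)}"


section \<open>Invariant partitions and strong orbit primitivity\<close>

text \<open>
  The action of a group \<open>G\<close> on \<open>S\<close> is given by \<open>\<phi>\<close>, as for \<^const>\<open>orbits\<close>; nothing here depends on
  whether it is a left or a right action.
\<close>

definition invariant_partition ::
    "('g, 'm) monoid_scheme \<Rightarrow> 's set \<Rightarrow> ('g \<Rightarrow> 's \<Rightarrow> 's) \<Rightarrow> 's set set \<Rightarrow> bool"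
  where "invariant_partition G S \<phi> \<P> \<longleftrightarrow>
    partition_on S \<P> \<and> (\<forall>P\<in>\<P>. \<forall>g\<in>carrier G. \<phi> g ` P \<in> \<P>)"

definition strongly_orbit_primitive ::
    "('g, 'm) monoid_scheme \<Rightarrow> 's set \<Rightarrow> ('g \<Rightarrow> 's \<Rightarrow> 's) \<Rightarrow> bool"
  where "strongly_orbit_primitive G S \<phi> \<longleftrightarrow>
    (\<forall>\<P>. invariant_partition G S \<phi> \<P> \<longrightarrow>
      (\<forall>P\<in>\<P>. is_singleton P \<or> (\<exists>B\<in>orbits G S \<phi>. B \<subseteq> P)))"


section \<open>Basic facts\<close>

lemma group_symmetric_group: "group (symmetric_group X)"
proof (rule groupI)
  fix p assume "p \<in> carrier (symmetric_group X)"
  then have "p permutes X" by (simp add: symmetric_group_def)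
  then show "\<exists>q\<in>carrier (symmetric_group X). q \<otimes>\<^bsub>symmetric_group X\<^esub> p = \<one>\<^bsub>symmetric_group X\<^esub>"
    by (intro bexI[of _ "inv_into UNIV p"])
       (auto simp: symmetric_group_def permutes_inv permutes_inv_o)
qed (auto simp: symmetric_group_def permutes_compose permutes_id comp_assoc)

lemma inv_symmetric_group:
  assumes "p permutes X"
  shows "m_inv (symmetric_group X) p = inv_into UNIV p"
proof -
  interpret group "symmetric_group X" by (rule group_symmetric_group)
  show ?thesis
    using assms by (intro inv_equality) (auto simp: symmetric_group_def permutes_inv permutes_inv_o)
qed

lemma finitary_permutation: "p permutes X \<Longrightarrow> finitary p \<longleftrightarrow> permutation p"
  by (simp add: permutation finitary_def supp_def permutes_bij)

lemma carrier_alternating_group: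
  "carrier (alternating_group X) = {p. p permutes X \<and> finitary p \<and> evenperm p}"
  by (simp add: alternating_group_def)

lemma subgroup_alternating_group:
  "subgroup (carrier (alternating_group X)) (symmetric_group X)"
proof (rule group.subgroupI[OF group_symmetric_group])
  show "carrier (alternating_group X) \<subseteq> carrier (symmetric_group X)"
    by (auto simp: alternating_group_def symmetric_group_def)
  have "id \<in> carrier (alternating_group X)"
    by (simp add: alternating_group_def finitary_def supp_def permutes_id)
  then show "carrier (alternating_group X) \<noteq> {}" by blast
next
  fix p assume "p \<in> carrier (alternating_group X)"
  then have "p permutes X" "permutation p" "evenperm p"
    by (auto simp: alternating_group_def finitary_permutation)
  then show "m_inv (symmetric_group X) p \<in> carrier (alternating_group X)"
    by (auto simp: alternating_group_def finitary_permutation[OF permutes_inv] inv_symmetric_group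
        permutes_inv permutation_inverse evenperm_inv)
next
  fix p q assume "p \<in> carrier (alternating_group X)" "q \<in> carrier (alternating_group X)"
  then have "p permutes X" "permutation p" "evenperm p" "q permutes X" "permutation q" "evenperm q"
    by (auto simp: alternating_group_def finitary_permutation)
  then show "p \<otimes>\<^bsub>symmetric_group X\<^esub> q \<in> carrier (alternating_group X)"
    by (auto simp: alternating_group_def symmetric_group_def finitary_permutation[OF permutes_compose] permutes_compose
        permutation_compose evenperm_comp)
qed

lemma group_alternating_group: "group (alternating_group X)"
  using group.subgroup_imp_group[OF group_symmetric_group subgroup_alternating_group]
  by (simp add: alternating_group_def)

lemma carrier_alternating_group_subset_direct_sum:
  fixes X :: "'i \<Rightarrow> 'a set"
  assumes disj: "disjoint_family_on X I" and j: "j \<in> I"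
  shows "carrier (alternating_group (X j)) \<subseteq> alternating_direct_sum I X"
proof
  fix p assume p: "p \<in> carrier (alternating_group (X j))"
  then have perm: "p permutes X j" by (simp add: alternating_group_def)
  define x where "x = (\<lambda>i\<in>I. if i = j then p else id)"
  have one: "\<one>\<^bsub>alternating_group Y\<^esub> = id" for Y :: "'a set"
    by (simp add: alternating_group_def symmetric_group_def)
  have "id \<in> carrier (alternating_group Y)" for Y :: "'a set"
    using group.is_monoid[OF group_alternating_group, THEN monoid.one_closed, of Y] by (simp add: one)
  moreover have "finite {i \<in> I. x i \<noteq> id}"
    by (rule finite_subset[of _ "{j}"]) (auto simp: x_def split: if_splits)
  ultimately have "x \<in> carrier (sum_group I (\<lambda>i. alternating_group (X i)))"
    using p by (auto simp: carrier_sum_group group_alternating_group one x_def)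
  moreover have "p w = x i w" if "i \<in> I" "w \<in> X i" for i w
  proof (cases "i = j")
    case False
    with disj j that have "w \<notin> X j" by (auto simp: disjoint_family_on_def)
    with perm False that show ?thesis by (simp add: x_def permutes_not_in)
  qed (use that in \<open>simp add: x_def\<close>)
  moreover have "p permutes (\<Union>i\<in>I. X i)"
    using perm j by (meson UN_upper permutes_subset)
  ultimately show "p \<in> alternating_direct_sum I X"
    by (auto simp: alternating_direct_sum_def)
qed

lemma subgroup_alternating_direct_sum:
  fixes X :: "'i \<Rightarrow> 'a set"
  shows "subgroup (alternating_direct_sum I X) (symmetric_group (\<Union>i\<in>I. X i))"
proof (rule group.subgroupI[OF group_symmetric_group])
  let ?A = "\<lambda>i. alternating_group (X i)"
  interpret S: group "sum_group I ?A" by (simp add: group_alternating_group)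
  have mult: "g \<otimes>\<^bsub>alternating_group Y\<^esub> h = h \<circ> g" for Y :: "'a set" and g h
    by (simp add: alternating_group_def symmetric_group_def)
  have one: "\<one>\<^bsub>alternating_group Y\<^esub> = id" for Y :: "'a set"
    by (simp add: alternating_group_def symmetric_group_def)
  have comp: "x i permutes X i" if "x \<in> carrier (sum_group I ?A)" "i \<in> I" for x i
    using that by (auto simp: carrier_sum_group group_alternating_group PiE_iff carrier_alternating_group)
  show "alternating_direct_sum I X \<subseteq> carrier (symmetric_group (\<Union>i\<in>I. X i))"
    by (auto simp: alternating_direct_sum_def symmetric_group_def)
  have "id \<in> alternating_direct_sum I X"
    unfolding alternating_direct_sum_def
    using S.one_closed by (auto simp: permutes_id one intro!: bexI[of _ "\<one>\<^bsub>sum_group I ?A\<^esub>"])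
  then show "alternating_direct_sum I X \<noteq> {}" by blast
  show "m_inv (symmetric_group (\<Union>i\<in>I. X i)) g \<in> alternating_direct_sum I X"
    if g: "g \<in> alternating_direct_sum I X" for g
  proof -
    from g obtain x where perm: "g permutes (\<Union>i\<in>I. X i)" and x: "x \<in> carrier (sum_group I ?A)"
      and gx: "\<And>i w. i \<in> I \<Longrightarrow> w \<in> X i \<Longrightarrow> g w = x i w"
      unfolding alternating_direct_sum_def by auto
    define y where "y = m_inv (sum_group I ?A) x"
    have y: "y \<in> carrier (sum_group I ?A)" using x by (simp add: y_def)
    have "y \<otimes>\<^bsub>sum_group I ?A\<^esub> x = \<one>\<^bsub>sum_group I ?A\<^esub>"
      unfolding y_def using x by (rule S.l_inv)
    then have eq: "(y \<otimes>\<^bsub>sum_group I ?A\<^esub> x) i = \<one>\<^bsub>sum_group I ?A\<^esub> i" for i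
      by (rule fun_cong)
    have "x i \<circ> y i = id" if "i \<in> I" for i
      using eq[of i] that by (simp add: mult one)
    then have yx: "x i (y i w) = w" if "i \<in> I" for i w
      using that by (simp add: fun_eq_iff)
    have "inv_into UNIV g w = y i w" if "i \<in> I" "w \<in> X i" for i w
    proof -
      have "y i w \<in> X i" using comp[OF y that(1)] that(2) by (simp add: permutes_in_image)
      with gx yx that have "g (y i w) = w" by simp
      with perm show ?thesis by (metis permutes_inverses(2))
    qed
    with y perm show ?thesis
      by (auto simp: alternating_direct_sum_def inv_symmetric_group permutes_inv)
  qed
  show "g \<otimes>\<^bsub>symmetric_group (\<Union>i\<in>I. X i)\<^esub> h \<in> alternating_direct_sum I X"
    if g: "g \<in> alternating_direct_sum I X" and h: "h \<in> alternating_direct_sum I X" for g h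
  proof -
    from g obtain x where gp: "g permutes (\<Union>i\<in>I. X i)" and x: "x \<in> carrier (sum_group I ?A)"
      and gx: "\<And>i w. i \<in> I \<Longrightarrow> w \<in> X i \<Longrightarrow> g w = x i w"
      unfolding alternating_direct_sum_def by auto
    from h obtain y where hp: "h permutes (\<Union>i\<in>I. X i)" and y: "y \<in> carrier (sum_group I ?A)"
      and hy: "\<And>i w. i \<in> I \<Longrightarrow> w \<in> X i \<Longrightarrow> h w = y i w"
      unfolding alternating_direct_sum_def by auto
    have "x \<otimes>\<^bsub>sum_group I ?A\<^esub> y \<in> carrier (sum_group I ?A)" using x y by (rule S.m_closed)
    moreover have "h (g w) = (x \<otimes>\<^bsub>sum_group I ?A\<^esub> y) i w" if "i \<in> I" "w \<in> X i" for i w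
      using comp[OF x that(1)] that gx hy by (simp add: mult permutes_in_image)
    ultimately show ?thesis
      using gp hp unfolding alternating_direct_sum_def
      by (auto simp: symmetric_group_def permutes_compose intro!: bexI[of _ "x \<otimes>\<^bsub>sum_group I ?A\<^esub> y"])
  qed
qed

end

theory Submission
  imports Defs
begin

text \<open>
  It suffices to find every three-cycle of every orbit in \<open>\<Gamma>\<close>, since these generate the alternating
  groups.  The source of three-cycles is the observation that if two permutations have supports
  meeting in a single point \<open>a\<close>, their commutator is a three-cycle through \<open>a\<close>
  (\<open>commutator_eq_three_cycle\<close>).  Given the finitary element \<open>\<gamma>\<close> and a point \<open>a\<close> of its support, we
  therefore want an element \<open>h\<close> of the stabilizer \<open>\<Gamma>\<^sub>a\<close> that moves the finite set \<open>supp \<gamma> - {a}\<close>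
  off itself: then \<open>\<gamma>\<close> and its conjugate by \<open>h\<close> have supports meeting in \<open>a\<close> alone.  This treats all
  orbits at once: although \<open>\<gamma>\<close> moves points in every orbit, the commutator moves only three
  points, all in the orbit of \<open>a\<close>.

  By Neumann's separation lemma such an \<open>h\<close> exists as soon as \<open>\<Gamma>\<^sub>a\<close> has no finite orbit outside \<open>a\<close>.
  A finite orbit \<open>y\<Gamma>\<^sub>a\<close> amounts to a \<open>\<Gamma>\<close>-invariant relation \<open>r = (a, y)\<Gamma>\<close> in which every point
  has finitely many successors, so what has to be shown is that such a locally finite invariant
  relation on \<open>\<Omega>\<close> is contained in the identity (\<open>locally_finite_invariant_trivial\<close>).  Primitivity shows
  first that the finitary elements of \<open>\<Gamma>\<close> already act transitively on each orbit.  Because a finitary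
  element fixes almost everything, it follows that the converse of \<open>r\<close> is locally finite
  (\<open>locally_finite_converse\<close>) and that the reflexive transitive closure of \<open>r\<close> is
  locally finite (\<open>locally_finite_rtrancl\<close>).  Hence the equivalence relation generated by \<open>r\<close> has finite
  classes; these cannot contain an infinite orbit, so strong orbit primitivity makes them
  singletons.

  Finally, "equal or moved by a common three-cycle of \<open>\<Gamma>\<close> from one to the other" is an invariant
  equivalence relation, so by primitivity any two points of an orbit lie on a common three-cycle, and
  a short computation with three-cycles yields all of them (\<open>three_cycles_of_orbit\<close>).
\<close>

section \<open>Three-cycles\<close>

definition three_cycle :: "'a \<Rightarrow> 'a \<Rightarrow> 'a \<Rightarrow> 'a \<Rightarrow> 'a"
  where "three_cycle a b c = transpose a b \<circ> transpose b c"

lemma three_cycle_apply: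
  assumes "distinct [a, b, c]"
  shows "three_cycle a b c x = (if x = a then b else if x = b then c else if x = c then a else x)"
  using assms by (auto simp: three_cycle_def transpose_def)

lemma three_cycle_rotate:
  assumes "distinct [a, b, c]"
  shows "three_cycle b c a = three_cycle a b c"
proof
  have "distinct [b, c, a]" using assms by auto
  then show "three_cycle b c a x = three_cycle a b c x" for x
    unfolding three_cycle_apply[OF assms] three_cycle_apply[OF \<open>distinct [b, c, a]\<close>]
    using assms by auto
qed

lemma inv_three_cycle:
  assumes "distinct [a, b, c]"
  shows "inv_into UNIV (three_cycle a b c) = three_cycle a c b"
proof (rule inv_unique_comp)
  have d: "distinct [a, c, b]" using assms by auto
  show "three_cycle a b c \<circ> three_cycle a c b = id" "three_cycle a c b \<circ> three_cycle a b c = id"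
    unfolding fun_eq_iff comp_apply id_apply three_cycle_apply[OF assms] three_cycle_apply[OF d]
    using assms by auto
qed

lemma three_cycle_conjugate:
  assumes "bij g"
  shows "g \<circ> three_cycle a b c \<circ> inv_into UNIV g = three_cycle (g a) (g b) (g c)"
proof
  fix x
  obtain y where x: "x = g y" using bij_is_surj[OF assms] by blast
  have inj: "g u = g v \<longleftrightarrow> u = v" for u v using assms by (simp add: bij_is_inj inj_eq)
  have "inv_into UNIV g x = y" unfolding x using assms by (simp add: bij_is_inj)
  then show "(g \<circ> three_cycle a b c \<circ> inv_into UNIV g) x = three_cycle (g a) (g b) (g c) x"
    unfolding x by (simp add: three_cycle_def transpose_def inj)
qed

lemma evenperm_three_cycle:
  "distinct [a, b, c] \<Longrightarrow> evenperm (three_cycle a b c)"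
  by (simp add: three_cycle_def evenperm_comp permutation_swap_id evenperm_swap)

text \<open>
  Away from \<open>a\<close> each point is moved by at most one of \<open>f\<close> and \<open>k\<close>, so the two commute except along
  the paths through \<open>a\<close>; the commutator records just this discrepancy.
\<close>

lemma commutator_eq_three_cycle:
  assumes f: "bij f" and k: "bij k" and int: "supp f \<inter> supp k = {a}"
  shows "distinct [a, f a, k a]"
    and "f \<circ> k \<circ> inv_into UNIV f \<circ> inv_into UNIV k = three_cycle a (f a) (k a)"
proof -
  have injf: "f x = f y \<longleftrightarrow> x = y" and injk: "k x = k y \<longleftrightarrow> x = y" for x y
    using f k by (simp_all add: bij_is_inj inj_eq)
  have a: "f a \<noteq> a" "k a \<noteq> a"
    using int by (auto simp: supp_def)
  have only: "f x = x \<or> k x = x" if "x \<noteq> a" for x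
    using int that by (auto simp: supp_def)
  have kf: "k (f a) = f a" and fk: "f (k a) = k a"
    using only[of "f a"] only[of "k a"] a injf injk by auto
  show d: "distinct [a, f a, k a]"
    using a kf injk[of "f a" a] injk by auto
  \<comment> \<open>Without inverses the claim reads \<open>f k = (a, f a, k a) k f\<close>, which is checked point by point.\<close>
  have "f (k x) = three_cycle a (f a) (k a) (k (f x))" for x
  proof (cases "x = a")
    case True
    then show ?thesis using d a kf fk by (simp add: three_cycle_apply)
  next
    case False
    then consider "f x = x" "k x = x" | "f x \<noteq> x" "k x = x" | "f x = x" "k x \<noteq> x"
      using only by blast
    then show ?thesis
    proof cases
      case 1
      moreover have "x \<noteq> f a" "x \<noteq> k a" using 1 False injf injk by metis+
      ultimately show ?thesis using False d
        by (simp add: three_cycle_apply)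
    next
      case 2
      have "f x = a \<or> k (f x) = f x"
        using only[of "f x"] 2(1) injf by blast
      with 2 False d injf fk show ?thesis
        by (auto simp: three_cycle_apply)
    next
      case 3
      have "k x = a \<or> f (k x) = k x"
        using only[of "k x"] 3(2) injk by blast
      moreover have "k x \<noteq> f a" using 3 kf injk by metis
      ultimately show ?thesis using 3 False d injk kf
        by (auto simp: three_cycle_apply)
    qed
  qed
  then have "f (k (inv_into UNIV f (inv_into UNIV k x))) = three_cycle a (f a) (k a) x" for x
    by (simp add: bij_is_surj f k surj_f_inv_f)
  then show "f \<circ> k \<circ> inv_into UNIV f \<circ> inv_into UNIV k = three_cycle a (f a) (k a)"
    by (simp add: fun_eq_iff)
qed

text \<open>
  Induction on the size of the support: if \<open>a\<close> is moved to \<open>p a\<close>, then a three-cycle sending \<open>p a\<close> back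
  to \<open>a\<close> makes \<open>a\<close> a fixed point.  Its third point \<open>c\<close> must come from the support of \<open>p\<close>, so that the
  support does not grow; such a \<open>c\<close> exists because \<open>p\<close>, being even, is not a transposition.
\<close>

lemma even_finitary_in_three_cycle_closure:
  assumes "p permutes X" and "finitary p" and "evenperm p"
    and id: "id \<in> G"
    and comp: "\<And>g h. g \<in> G \<Longrightarrow> h \<in> G \<Longrightarrow> g \<circ> h \<in> G"
    and cycles: "\<And>a b c. \<lbrakk>a \<in> X; b \<in> X; c \<in> X; distinct [a, b, c]\<rbrakk> \<Longrightarrow> three_cycle a b c \<in> G"
  shows "p \<in> G"
  using assms(1-3)
proof (induction "card (supp p)" arbitrary: p rule: less_induct)
  case less
  have fin: "finite (supp p)" and bij: "bij p"
    using less.prems by (auto simp: finitary_def permutes_bij)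
  have inj: "p x = p y \<longleftrightarrow> x = y" for x y
    using bij by (simp add: bij_is_inj inj_eq)
  show ?case
  proof (cases "supp p = {}")
    case True
    then have "p = id" by (auto simp: supp_def)
    with id show ?thesis by simp
  next
    case False
    then obtain a where a: "a \<in> supp p" by blast
    have b: "p a \<in> supp p" "p a \<noteq> a"
      using a inj by (auto simp: supp_def)
    have "\<not> supp p \<subseteq> {a, p a}"
    proof
      assume sub: "supp p \<subseteq> {a, p a}"
      have "p (p a) \<in> supp p" using b inj by (auto simp: supp_def)
      moreover have "p (p a) \<noteq> p a" using b inj by simp
      ultimately have "p (p a) = a" using sub by blast
      moreover have "p x = x" if "x \<noteq> a" "x \<noteq> p a" for x
        using that sub by (auto simp: supp_def)
      ultimately have "p = transpose a (p a)"
        by (auto simp: fun_eq_iff transpose_def)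
      then have "evenperm (transpose a (p a))" using less.prems(3) by simp
      with b(2) show False by (simp add: evenperm_swap)
    qed
    then obtain c where c: "c \<in> supp p" "c \<noteq> a" "c \<noteq> p a" by blast
    have d: "distinct [p a, a, c]" using b c by auto
    define t where "t = three_cycle (p a) a c"
    have suppX: "supp p \<subseteq> X"
      using less.prems(1) by (auto simp: supp_def permutes_def)
    have t_perm: "t permutes X"
      unfolding t_def three_cycle_def
      by (intro permutes_compose permutes_swap_id) (use suppX a b c in auto)
    have perm: "t \<circ> p permutes X"
      using less.prems(1) t_perm by (rule permutes_compose)
    have sub: "supp (t \<circ> p) \<subset> supp p"
    proof
      show "supp (t \<circ> p) \<subseteq> supp p"
      proof
        fix x assume "x \<in> supp (t \<circ> p)"
        moreover have "t (p x) = x" if "p x = x"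
          using that a b c by (auto simp: t_def three_cycle_apply[OF d] supp_def)
        ultimately show "x \<in> supp p" by (auto simp: supp_def)
      qed
      have "a \<notin> supp (t \<circ> p)" by (simp add: supp_def t_def three_cycle_apply[OF d])
      with a show "supp (t \<circ> p) \<noteq> supp p" by blast
    qed
    have t_even: "evenperm t" "permutation t"
      using evenperm_three_cycle[OF d]
      by (simp_all add: t_def three_cycle_def permutation_compose permutation_swap_id)
    have p_perm: "permutation p" using less.prems finitary_permutation by blast
    have "finitary (t \<circ> p)"
      using fin sub by (meson finitary_def finite_subset psubset_imp_subset)
    moreover have "evenperm (t \<circ> p)"
      using t_even p_perm less.prems(3) by (simp add: evenperm_comp)
    moreover have "card (supp (t \<circ> p)) < card (supp p)"
      using fin sub by (rule psubset_card_mono)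
    ultimately have "t \<circ> p \<in> G"
      using less.hyps perm by blast
    moreover have "three_cycle (p a) c a \<in> G"
      using cycles suppX a b c by auto
    moreover have "three_cycle (p a) c a \<circ> (t \<circ> p) = p"
    proof -
      have "three_cycle (p a) c a (t y) = y" for y
        unfolding t_def using d by (auto simp: three_cycle_apply)
      then show ?thesis by (simp add: fun_eq_iff)
    qed
    ultimately show ?thesis using comp[of "three_cycle (p a) c a" "t \<circ> p"] by simp
  qed
qed


section \<open>Moving a finite set off itself\<close>

locale permutation_group =
  fixes \<Omega> :: "'a set" and \<Gamma> :: "('a \<Rightarrow> 'a) set"
  assumes subgroup: "subgroup \<Gamma> (symmetric_group \<Omega>)"
begin

lemma permutes: "g \<in> \<Gamma> \<Longrightarrow> g permutes \<Omega>"
  using subgroup.subset[OF subgroup] by (auto simp: symmetric_group_def)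

lemma bij: "g \<in> \<Gamma> \<Longrightarrow> bij g"
  using permutes_bij[OF permutes] .

lemma in_Omega_iff: "g \<in> \<Gamma> \<Longrightarrow> g x \<in> \<Omega> \<longleftrightarrow> x \<in> \<Omega>"
  using permutes_in_image[OF permutes] .

lemma id_closed: "id \<in> \<Gamma>"
  using subgroup.one_closed[OF subgroup] by (simp add: symmetric_group_def)

lemma comp_closed: "g \<in> \<Gamma> \<Longrightarrow> h \<in> \<Gamma> \<Longrightarrow> g \<circ> h \<in> \<Gamma>"
  using subgroup.m_closed[OF subgroup, of h g] by (simp add: symmetric_group_def)

lemma inv_closed: "g \<in> \<Gamma> \<Longrightarrow> inv_into UNIV g \<in> \<Gamma>"
  using subgroup.m_inv_closed[OF subgroup, of g] by (simp add: inv_symmetric_group permutes)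

lemma inv_apply: "g \<in> \<Gamma> \<Longrightarrow> inv_into UNIV g (g x) = x" "g \<in> \<Gamma> \<Longrightarrow> g (inv_into UNIV g x) = x"
  using permutes_inverses[OF permutes] by simp_all

abbreviation orb :: "'a \<Rightarrow> 'a set"
  where "orb x \<equiv> (\<lambda>g. g x) ` \<Gamma>"

lemma orbits_eq: "orbits ((symmetric_group \<Omega>)\<lparr>carrier := \<Gamma>\<rparr>) \<Omega> (\<lambda>g. g) = orb ` \<Omega>"
  by (simp add: orbits_def orbit_def Setcompr_eq_image)

lemma self_in_orb: "x \<in> orb x"
  using image_eqI[of x "\<lambda>g. g x" id \<Gamma>] id_closed by simp

lemma orb_eq:
  assumes "y \<in> orb x"
  shows "orb y = orb x"
proof -
  have trans: "orb v \<subseteq> orb u" if "v \<in> orb u" for u v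
  proof
    fix w assume "w \<in> orb v"
    with that obtain g h where "g \<in> \<Gamma>" "v = g u" "h \<in> \<Gamma>" "w = h v" by blast
    then have "h \<circ> g \<in> \<Gamma>" "w = (h \<circ> g) u" using comp_closed by simp_all
    then show "w \<in> orb u" by blast
  qed
  from assms obtain g where "g \<in> \<Gamma>" "y = g x" by blast
  then have "x \<in> orb y" using inv_closed inv_apply(1) by (metis image_eqI)
  with assms trans show ?thesis by blast
qed

lemma orb_subset_Omega: "x \<in> \<Omega> \<Longrightarrow> orb x \<subseteq> \<Omega>"
  using in_Omega_iff by auto

lemma stabilizer: "permutation_group \<Omega> {g \<in> \<Gamma>. g a = a}"
proof (rule permutation_group.intro)
  show "subgroup {g \<in> \<Gamma>. g a = a} (symmetric_group \<Omega>)"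
  proof (rule group.subgroupI[OF group_symmetric_group])
    show "{g \<in> \<Gamma>. g a = a} \<subseteq> carrier (symmetric_group \<Omega>)"
      using permutes by (auto simp: symmetric_group_def)
    show "{g \<in> \<Gamma>. g a = a} \<noteq> {}"
      using id_closed by force
  next
    fix g assume "g \<in> {g \<in> \<Gamma>. g a = a}"
    then have g: "g \<in> \<Gamma>" "g a = a" by simp_all
    then have "inv_into UNIV g a = a" using inv_apply(1)[OF g(1), of a] by simp
    with g show "m_inv (symmetric_group \<Omega>) g \<in> {g \<in> \<Gamma>. g a = a}"
      using inv_closed by (simp add: inv_symmetric_group permutes)
  next
    fix g h assume "g \<in> {g \<in> \<Gamma>. g a = a}" "h \<in> {g \<in> \<Gamma>. g a = a}"
    then show "g \<otimes>\<^bsub>symmetric_group \<Omega>\<^esub> h \<in> {g \<in> \<Gamma>. g a = a}"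
      using comp_closed by (auto simp: symmetric_group_def)
  qed
qed

text \<open>
  B. H. Neumann's lemma that a group is not a finite union of cosets of subgroups of infinite index,
  for cosets of point stabilizers: the pair \<open>(a, c)\<close> in \<open>S\<close> stands for the coset of all \<open>g\<close> with
  \<open>g a = c\<close>.  The induction is on the number of stabilizers involved.  If the cosets covered the
  group, then a coset of the stabilizer of \<open>a\<close> missing from \<open>S\<close> would be covered by cosets of the other
  stabilizers.  All cosets of the stabilizer of \<open>a\<close> are translates of each other, so those
  belonging to \<open>S\<close> could be replaced by cosets of other stabilizers, eliminating \<open>a\<close>.
\<close>

lemma avoid_finite_relation:
  assumes "finite S" and "\<And>a. a \<in> Domain S \<Longrightarrow> infinite (orb a)"
  shows "\<exists>g\<in>\<Gamma>. \<forall>(a, c)\<in>S. g a \<noteq> c"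
  using assms
proof (induction "card (Domain S)" arbitrary: S rule: less_induct)
  case less
  show ?case
  proof (cases "S = {}")
    case True
    with id_closed show ?thesis by auto
  next
    case False
    then obtain a where a: "a \<in> Domain S" by auto
    show ?thesis
    proof (rule ccontr)
      assume "\<not> ?thesis"
      then have bad: "\<exists>(a, c)\<in>S. g a = c" if "g \<in> \<Gamma>" for g
        using that by blast
      have finA: "finite (S `` {a})"
        using less.prems(1) by (rule finite_Image)
      then have "\<not> orb a \<subseteq> S `` {a}"
        using less.prems(2)[OF a] finite_subset by blast
      then obtain x where x: "x \<in> \<Gamma>" "(a, x a) \<notin> S" by blast
      \<comment> \<open>\<open>S'\<close> would cover the missing coset of all \<open>g\<close> with \<open>g a = x a\<close>; translating by \<open>h c x\<inverse>\<close> would cover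
        the one of all \<open>g\<close> with \<open>g a = c\<close>.\<close>
      define S' where "S' = {p \<in> S. fst p \<noteq> a}"
      define h where "h c = (SOME g. g \<in> \<Gamma> \<and> g a = c)" for c
      have h: "h c \<in> \<Gamma> \<and> h c a = c" if "g \<in> \<Gamma>" "g a = c" for g c
        unfolding h_def by (rule someI[of _ g]) (use that in simp)
      define S'' where "S'' = S' \<union>
        (\<lambda>((b, d), c). (b, h c (inv_into UNIV x d))) ` (S' \<times> S `` {a})"
      have fin: "finite S''"
        unfolding S''_def S'_def using less.prems(1) finA by simp
      have dom: "Domain S'' \<subseteq> Domain S - {a}"
        unfolding S''_def S'_def by auto
      have "Domain S'' \<subset> Domain S" using dom a by blast
      then have "card (Domain S'') < card (Domain S)"
        using less.prems(1) by (intro psubset_card_mono) (simp_all add: finite_Domain)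
      moreover have "infinite (orb b)" if "b \<in> Domain S''" for b
        using that dom less.prems(2) by blast
      ultimately obtain g where g: "g \<in> \<Gamma>" "\<forall>(b, c)\<in>S''. g b \<noteq> c"
        using less.hyps fin by metis
      from bad[OF g(1)] obtain b c where bc: "(b, c) \<in> S" "g b = c" by blast
      have "b = a"
        using bc g(2) unfolding S''_def S'_def by auto
      with bc have c: "(a, c) \<in> S" "g a = c" by simp_all
      with h g(1) have hc: "h c \<in> \<Gamma>" "h c a = c" by blast+
      let ?g = "x \<circ> inv_into UNIV (h c) \<circ> g"
      have "?g \<in> \<Gamma>" using x hc g(1) comp_closed inv_closed by blast
      from bad[OF this] obtain b' d where bd: "(b', d) \<in> S" "?g b' = d" by blast
      have "?g a = x a" using c hc inv_apply(1)[OF hc(1), of a] by simp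
      with bd x have "b' \<noteq> a" by auto
      with bd have "(b', d) \<in> S'" by (simp add: S'_def)
      with c have "(b', h c (inv_into UNIV x d)) \<in> S''"
        unfolding S''_def by force
      moreover have "g b' = h c (inv_into UNIV x d)"
        using bd(2)[symmetric] inv_apply(1)[OF x(1)] inv_apply(2)[OF hc(1)] by simp
      ultimately show False using g(2) by blast
    qed
  qed
qed

corollary separation:
  assumes "finite A" and "finite B" and "\<And>a. a \<in> A \<Longrightarrow> infinite (orb a)"
  shows "\<exists>g\<in>\<Gamma>. g ` A \<inter> B = {}"
  using avoid_finite_relation[of "A \<times> B"] assms by fastforce

end


section \<open>Locally finite invariant relations\<close>

text \<open>
  In this section a relation is locally finite if every point has finitely many successors.
\<close>

definition (in permutation_group) invariant_rel :: "'a rel \<Rightarrow> bool"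
  where "invariant_rel r \<longleftrightarrow>
    r \<subseteq> \<Omega> \<times> \<Omega> \<and> (\<forall>g\<in>\<Gamma>. \<forall>(x, y)\<in>r. (g x, g y) \<in> r)"

lemma (in permutation_group) invariant_relD:
  assumes "invariant_rel r" and "g \<in> \<Gamma>"
  shows "(g x, g y) \<in> r \<longleftrightarrow> (x, y) \<in> r"
proof
  assume "(g x, g y) \<in> r"
  then have "(inv_into UNIV g (g x), inv_into UNIV g (g y)) \<in> r"
    using assms inv_closed unfolding invariant_rel_def by blast
  then show "(x, y) \<in> r" using assms(2) inv_apply(1) by simp
qed (use assms in \<open>auto simp: invariant_rel_def\<close>)

locale primitive_finitary_group = permutation_group +
  fixes \<gamma> :: "'a \<Rightarrow> 'a"
  assumes finite_orbits: "finite (orb ` \<Omega>)"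
    and infinite_orb: "x \<in> \<Omega> \<Longrightarrow> infinite (orb x)"
    and gamma: "\<gamma> \<in> \<Gamma>" "finitary \<gamma>"
    and gamma_meets: "x \<in> \<Omega> \<Longrightarrow> supp \<gamma> \<inter> orb x \<noteq> {}"
    and primitive: "\<lbrakk>equiv \<Omega> r; invariant_rel r; x \<in> \<Omega>\<rbrakk> \<Longrightarrow> r `` {x} = {x} \<or> (\<exists>y\<in>\<Omega>. orb y \<subseteq> r `` {x})"
begin

lemma finitary_comp: "finitary g \<Longrightarrow> finitary h \<Longrightarrow> finitary (g \<circ> h)"
  unfolding finitary_def by (rule finite_subset[of _ "supp g \<union> supp h"]) (auto simp: supp_def)

lemma supp_inv: "g \<in> \<Gamma> \<Longrightarrow> supp (inv_into UNIV g) = supp g"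
proof -
  assume g: "g \<in> \<Gamma>"
  have "inv_into UNIV g x = x \<longleftrightarrow> g x = x" for x
    using bij_inv_eq_iff[OF bij[OF g], of x x] by auto
  then show ?thesis by (simp add: supp_def)
qed

lemma supp_conjugate:
  assumes "h \<in> \<Gamma>"
  shows "supp (h \<circ> g \<circ> inv_into UNIV h) = h ` supp g"
proof -
  show ?thesis
  proof (rule subset_antisym; rule subsetI)
    fix x assume "x \<in> supp (h \<circ> g \<circ> inv_into UNIV h)"
    then have "inv_into UNIV h x \<in> supp g"
      using inv_apply(2)[OF assms] by (auto simp: supp_def)
    then show "x \<in> h ` supp g"
      using inv_apply(2)[OF assms, of x] by (metis image_eqI)
  next
    fix x assume "x \<in> h ` supp g"
    then obtain y where "x = h y" "g y \<noteq> y" by (auto simp: supp_def)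
    then show "x \<in> supp (h \<circ> g \<circ> inv_into UNIV h)"
      using inv_apply(1)[OF assms] bij[OF assms] by (simp add: supp_def bij_is_inj inj_eq)
  qed
qed

text \<open>
  The form in which primitivity produces elements: a class inside an orbit is that entire orbit once
  it has two points.
\<close>

lemma primitive_within_orbits:
  assumes "equiv \<Omega> r" and "invariant_rel r"
    and within: "\<And>x y. (x, y) \<in> r \<Longrightarrow> y \<in> orb x"
    and "(x, y) \<in> r" and "x \<noteq> y" and z: "z \<in> orb x"
  shows "(x, z) \<in> r"
proof -
  have "x \<in> \<Omega>" using assms(2,4) by (auto simp: invariant_rel_def)
  moreover have "r `` {x} \<noteq> {x}" using assms(4,5) by auto
  ultimately obtain w where w: "w \<in> \<Omega>" "orb w \<subseteq> r `` {x}"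
    using primitive[OF assms(1,2)] by metis
  then have "(x, w) \<in> r" using self_in_orb[of w] by blast
  then have "w \<in> orb x" by (rule within)
  then have "orb w = orb x" by (rule orb_eq)
  with z w show ?thesis by blast
qed

text \<open>
  The orbits of the normal subgroup of finitary elements form an invariant partition, which is not
  trivial on any orbit since the support of \<open>\<gamma>\<close> meets them all.
\<close>

lemma finitary_transitive:
  assumes x: "x \<in> \<Omega>" and y: "y \<in> orb x"
  shows "\<exists>n\<in>\<Gamma>. finitary n \<and> n x = y"
proof -
  define r where "r = {(x, y). x \<in> \<Omega> \<and> (\<exists>n\<in>\<Gamma>. finitary n \<and> n x = y)}"
  have inv: "invariant_rel r"
    unfolding invariant_rel_def
  proof (intro conjI ballI; clarify?)
    show "\<And>x y. (x, y) \<in> r \<Longrightarrow> x \<in> \<Omega> \<and> y \<in> \<Omega>"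
      by (auto simp: r_def in_Omega_iff)
    fix g x y assume g: "g \<in> \<Gamma>" and "(x, y) \<in> r"
    then obtain n where n: "x \<in> \<Omega>" "n \<in> \<Gamma>" "finitary n" "n x = y" by (auto simp: r_def)
    let ?n = "g \<circ> n \<circ> inv_into UNIV g"
    have "?n \<in> \<Gamma>" using g n comp_closed inv_closed by blast
    moreover have "finitary ?n" using n(3) by (simp add: finitary_def supp_conjugate g)
    moreover have "?n (g x) = g y" using g n by (simp add: inv_apply)
    ultimately show "(g x, g y) \<in> r" using g n in_Omega_iff unfolding r_def by blast
  qed
  have equiv: "equiv \<Omega> r"
  proof (rule equivI)
    show "r \<subseteq> \<Omega> \<times> \<Omega>" using inv by (simp add: invariant_rel_def)
    have "finitary id" by (simp add: finitary_def supp_def)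
    then show "refl_on \<Omega> r"
      using id_closed by (auto simp: refl_on_def r_def)
    show "sym r"
    proof (rule symI)
      fix x y assume "(x, y) \<in> r"
      then obtain n where n: "x \<in> \<Omega>" "n \<in> \<Gamma>" "finitary n" "n x = y" by (auto simp: r_def)
      then have "inv_into UNIV n y = x" using inv_apply(1) by blast
      moreover have "finitary (inv_into UNIV n)" using n by (simp add: finitary_def supp_inv)
      ultimately show "(y, x) \<in> r"
        using n inv_closed in_Omega_iff unfolding r_def by blast
    qed
    show "trans r"
    proof (rule transI)
      fix x y z assume "(x, y) \<in> r" "(y, z) \<in> r"
      then obtain n m where "x \<in> \<Omega>" "n \<in> \<Gamma>" "finitary n" "n x = y" "m \<in> \<Gamma>" "finitary m" "m y = z"
        by (auto simp: r_def)
      then show "(x, z) \<in> r"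
        using comp_closed finitary_comp unfolding r_def by (auto intro!: bexI[of _ "m \<circ> n"])
    qed
  qed
  obtain z where z: "z \<in> supp \<gamma>" "z \<in> orb x" using gamma_meets[OF x] by blast
  have zO: "z \<in> \<Omega>" using z x orb_subset_Omega by blast
  have orb: "orb z = orb x" using z(2) by (rule orb_eq)
  have "(z, \<gamma> z) \<in> r" using gamma zO by (auto simp: r_def)
  moreover have "z \<noteq> \<gamma> z" using z(1) by (auto simp: supp_def)
  moreover have "\<And>x y. (x, y) \<in> r \<Longrightarrow> y \<in> orb x" by (auto simp: r_def)
  ultimately have "(z, w) \<in> r" if "w \<in> orb x" for w
    using primitive_within_orbits[OF equiv inv] that orb by blast
  then have "(z, x) \<in> r" "(z, y) \<in> r" using y self_in_orb by blast+
  then have "(x, y) \<in> r" using equiv by (meson equiv_def symE transE)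
  then show ?thesis by (auto simp: r_def)
qed

lemma finite_representatives:
  obtains R where "finite R" "R \<subseteq> \<Omega>" "\<And>x. x \<in> \<Omega> \<Longrightarrow> \<exists>u\<in>R. x \<in> orb u"
proof -
  obtain R where R: "R \<subseteq> \<Omega>" "finite R" "orb ` \<Omega> = orb ` R"
    using finite_subset_image[OF finite_orbits order_refl] by metis
  have "\<exists>u\<in>R. x \<in> orb u" if "x \<in> \<Omega>" for x
  proof -
    have "orb x \<in> orb ` R" using that R(3) by blast
    then obtain u where u: "u \<in> R" "orb x = orb u" by blast
    have "x \<in> orb u" using self_in_orb[of x] unfolding u(2) .
    with u(1) show ?thesis by blast
  qed
  with R that show thesis by blast
qed

text \<open>
  If \<open>y\<close> had infinitely many predecessors, then a finitary element moving \<open>y\<close> to \<open>z\<close> would fix almost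
  all of them and so make them predecessors of \<open>z\<close>.  Doing this for many \<open>z\<close> at a time gives a
  point with more successors than the uniform bound allows; such a bound exists since there are only
  finitely many orbits.
\<close>

lemma locally_finite_converse:
  assumes inv: "invariant_rel r" and fin: "\<And>x. finite (r `` {x})"
  shows "finite (r\<inverse> `` {y})"
proof (rule ccontr)
  assume inf: "infinite (r\<inverse> `` {y})"
  then obtain x where "(x, y) \<in> r" by (metis Image_singleton_iff converse_iff finite.emptyI equals0I)
  then have y: "y \<in> \<Omega>" using inv by (auto simp: invariant_rel_def)
  obtain R where R: "finite R" "R \<subseteq> \<Omega>" "\<And>x. x \<in> \<Omega> \<Longrightarrow> \<exists>u\<in>R. x \<in> orb u"
    using finite_representatives by blast
  define m where "m = (\<Sum>u\<in>R. card (r `` {u}))"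
  have bound: "card (r `` {x}) \<le> m" if x: "x \<in> \<Omega>" for x
  proof -
    obtain u g where u: "u \<in> R" "g \<in> \<Gamma>" "x = g u" using R(3)[OF x] by blast
    have "r `` {x} \<subseteq> g ` (r `` {u})"
    proof
      fix z assume "z \<in> r `` {x}"
      then have "(g u, g (inv_into UNIV g z)) \<in> r" using u by (simp add: inv_apply)
      then have "(u, inv_into UNIV g z) \<in> r" using invariant_relD[OF inv u(2)] by blast
      then show "z \<in> g ` (r `` {u})" using inv_apply(2)[OF u(2), of z] by force
    qed
    then have "card (r `` {x}) \<le> card (r `` {u})"
      using fin by (meson card_image_le card_mono finite_imageI order_trans)
    also have "\<dots> \<le> m" unfolding m_def using R(1) u(1) by (intro member_le_sum) auto
    finally show ?thesis .
  qed
  obtain Y where Y: "Y \<subseteq> orb y" "finite Y" "card Y = Suc m"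
    using infinite_arbitrarily_large[OF infinite_orb[OF y], of "Suc m"] by blast
  have "\<forall>z\<in>Y. \<exists>n\<in>\<Gamma>. finitary n \<and> n y = z"
    using finitary_transitive[OF y] Y(1) by blast
  then obtain n where n: "\<And>z. z \<in> Y \<Longrightarrow> n z \<in> \<Gamma> \<and> finitary (n z) \<and> n z y = z" by metis
  have "finite (\<Union>z\<in>Y. supp (n z))" using Y(2) n by (auto simp: finitary_def)
  then have "infinite (r\<inverse> `` {y} - (\<Union>z\<in>Y. supp (n z)))" using inf by (rule Diff_infinite_finite)
  then obtain x where x: "(x, y) \<in> r" "x \<notin> (\<Union>z\<in>Y. supp (n z))"
    by (metis Diff_iff Image_singleton_iff converse_iff finite.emptyI equals0I)
  have "(x, z) \<in> r" if z: "z \<in> Y" for z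
  proof -
    have "(n z x, n z y) \<in> r" using invariant_relD[OF inv] n[OF z] x(1) by blast
    moreover have "n z x = x" using x(2) z by (auto simp: supp_def)
    ultimately show ?thesis using n[OF z] by simp
  qed
  then have "card Y \<le> card (r `` {x})" by (intro card_mono fin) auto
  moreover have "x \<in> \<Omega>" using x(1) inv by (auto simp: invariant_rel_def)
  ultimately show False using bound Y(3) by fastforce
qed

text \<open>
  Choose finitely many representatives \<open>R\<close> of the orbits.  Each of the finitely many successors \<open>y\<close> of
  \<open>R\<close> is the image of a representative \<open>u y\<close> under a finitary element \<open>n y\<close>.  These elements preserve
  a common finite set \<open>S\<close> that contains \<open>R\<close>, and the images of \<open>R\<close> under the elements preserving \<open>S\<close>
  form a finite set closed under successors: a successor of \<open>m x\<close> has the form \<open>m y\<close> with \<open>y\<close> a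
  successor of \<open>x\<close>, and \<open>m y = m (n y (u y))\<close>.
\<close>

lemma locally_finite_rtrancl:
  assumes inv: "invariant_rel r" and fin: "\<And>x. finite (r `` {x})" and a: "a \<in> \<Omega>"
  shows "finite (r\<^sup>* `` {a})"
proof -
  obtain R0 where R0: "finite R0" "R0 \<subseteq> \<Omega>" "\<And>x. x \<in> \<Omega> \<Longrightarrow> \<exists>u\<in>R0. x \<in> orb u"
    using finite_representatives by blast
  define R where "R = insert a R0"
  have R: "finite R" "R \<subseteq> \<Omega>" "a \<in> R" using R0 a by (auto simp: R_def)
  have "\<exists>u n. u \<in> R \<and> n \<in> \<Gamma> \<and> finitary n \<and> n u = y" if "y \<in> \<Omega>" for y
  proof -
    have "\<exists>u\<in>R. y \<in> orb u" using R0(3)[OF that] by (auto simp: R_def)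
    then show ?thesis using finitary_transitive R(2) by blast
  qed
  then obtain u n where un: "\<And>y. y \<in> \<Omega> \<Longrightarrow> u y \<in> R \<and> n y \<in> \<Gamma> \<and> finitary (n y) \<and> n y (u y) = y"
    by metis
  define W where "W = r `` R"
  have W: "finite W" "W \<subseteq> \<Omega>"
  proof -
    have "W = (\<Union>x\<in>R. r `` {x})" by (auto simp: W_def)
    then show "finite W" using R(1) fin by simp
    show "W \<subseteq> \<Omega>" using inv by (auto simp: W_def invariant_rel_def)
  qed
  define S where "S = R \<union> (\<Union>y\<in>W. supp (n y))"
  have S: "finite S" using R(1) W un by (auto simp: S_def finitary_def)
  define M where "M = {m \<in> \<Gamma>. m ` S \<subseteq> S}"
  have nM: "n y \<in> M" if y: "y \<in> W" for y
  proof -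
    have ny: "n y \<in> \<Gamma>" using y W un by blast
    have "n y x \<in> S" if "x \<in> S" for x
    proof (cases "n y x = x")
      case False
      then have "n y (n y x) \<noteq> n y x" using bij[OF ny] by (simp add: bij_is_inj inj_eq)
      then show ?thesis using y by (auto simp: S_def supp_def)
    qed (use that in simp)
    with ny show ?thesis by (auto simp: M_def)
  qed
  define C where "C = {m x |m x. m \<in> M \<and> x \<in> R}"
  have "finite C" using S by (rule rev_finite_subset) (auto simp: C_def M_def S_def)
  moreover have "z \<in> C" if "(a, z) \<in> r\<^sup>*" for z
    using that
  proof induction
    case base
    have "id \<in> M" using id_closed by (simp add: M_def)
    then show ?case using R(3) unfolding C_def by (metis (mono_tags, lifting) id_apply mem_Collect_eq)
  next
    case (step c z)
    then obtain m x where mx: "m \<in> M" "x \<in> R" "c = m x" by (auto simp: C_def)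
    have m: "m \<in> \<Gamma>" using mx by (simp add: M_def)
    define y where "y = inv_into UNIV m z"
    have z: "z = m y" using m by (simp add: y_def inv_apply)
    have "(x, y) \<in> r" using step.hyps(2) invariant_relD[OF inv m] mx z by blast
    then have y: "y \<in> W" using mx by (auto simp: W_def)
    have "m \<circ> n y \<in> M" using mx(1) nM[OF y] comp_closed by (fastforce simp: M_def)
    moreover have "z = (m \<circ> n y) (u y)" "u y \<in> R" using z un y W by auto
    ultimately show ?case unfolding C_def by blast
  qed
  ultimately show ?thesis by (meson Image_singleton_iff finite_subset subsetI)
qed

text \<open>
  The equivalence relation generated by \<open>r\<close> has finite classes, whereas orbits are infinite, so
  primitivity leaves only singletons.
\<close>

proposition locally_finite_invariant_trivial:
  assumes inv: "invariant_rel r" and fin: "\<And>x. finite (r `` {x})"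
  shows "r \<subseteq> Id"
proof -
  define q where "q = r \<union> r\<inverse>"
  define s where "s = q\<^sup>* \<inter> \<Omega> \<times> \<Omega>"
  have q: "invariant_rel q" using inv unfolding q_def invariant_rel_def by fast
  have "finite (q `` {x})" for x
    using fin locally_finite_converse[OF inv fin] by (simp add: q_def Un_Image)
  then have finq: "finite (q\<^sup>* `` {x})" if "x \<in> \<Omega>" for x
    using locally_finite_rtrancl[OF q _ that] by blast
  have "(g x, g y) \<in> q\<^sup>*" if "(x, y) \<in> q\<^sup>*" "g \<in> \<Gamma>" for g x y
    using that(1)
  proof induction
    case (step y z)
    then show ?case using invariant_relD[OF q that(2)] by (meson rtrancl.rtrancl_into_rtrancl)
  qed simp
  then have s: "invariant_rel s"
    using in_Omega_iff by (auto simp: invariant_rel_def s_def)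
  have "sym q" by (auto simp: q_def sym_def)
  then have "sym (q\<^sup>*)" by (rule sym_rtrancl)
  then have "equiv \<Omega> s"
    unfolding s_def
    by (intro equivI) (auto simp: refl_on_def sym_def trans_def intro: rtrancl_trans)
  then have single: "s `` {x} = {x}" if x: "x \<in> \<Omega>" for x
  proof -
    have "finite (s `` {x})" using finq[OF x] by (rule rev_finite_subset) (auto simp: s_def)
    then have "\<not> orb y \<subseteq> s `` {x}" if "y \<in> \<Omega>" for y
      using infinite_orb[OF that] finite_subset by blast
    with primitive[OF \<open>equiv \<Omega> s\<close> s x] show ?thesis by blast
  qed
  show ?thesis
  proof (rule subrelI)
    fix x y assume xy: "(x, y) \<in> r"
    then have "x \<in> \<Omega>" "y \<in> s `` {x}" using inv by (auto simp: s_def q_def invariant_rel_def)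
    with single show "(x, y) \<in> Id" by simp
  qed
qed

corollary infinite_stabilizer_orbit:
  assumes a: "a \<in> \<Omega>" and y: "y \<in> \<Omega>" and "y \<noteq> a"
  shows "infinite ((\<lambda>g. g y) ` {g \<in> \<Gamma>. g a = a})"
proof
  assume fin: "finite ((\<lambda>g. g y) ` {g \<in> \<Gamma>. g a = a})"
  define r where "r = (\<lambda>g. (g a, g y)) ` \<Gamma>"
  have inv: "invariant_rel r"
    unfolding invariant_rel_def
  proof (intro conjI ballI; clarify?)
    show "\<And>u v. (u, v) \<in> r \<Longrightarrow> u \<in> \<Omega> \<and> v \<in> \<Omega>" using a y by (auto simp: r_def in_Omega_iff)
    fix g u v assume "g \<in> \<Gamma>" "(u, v) \<in> r"
    then obtain h where "h \<in> \<Gamma>" "u = h a" "v = h y" by (auto simp: r_def)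
    with \<open>g \<in> \<Gamma>\<close> show "(g u, g v) \<in> r"
      unfolding r_def by (intro image_eqI[of _ _ "g \<circ> h"]) (auto intro: comp_closed)
  qed
  moreover have "finite (r `` {x})" for x
  proof (cases "x \<in> orb a")
    case True
    then obtain g where g: "g \<in> \<Gamma>" "x = g a" by blast
    have "r `` {x} \<subseteq> g ` (\<lambda>g. g y) ` {g \<in> \<Gamma>. g a = a}"
    proof
      fix z assume "z \<in> r `` {x}"
      then obtain h where h: "h \<in> \<Gamma>" "h a = g a" "z = h y" using g by (auto simp: r_def)
      let ?k = "inv_into UNIV g \<circ> h"
      have "?k \<in> \<Gamma>" using g h comp_closed inv_closed by blast
      moreover have "?k a = a" using h inv_apply(1)[OF g(1)] by simp
      moreover have "z = g (?k y)" using h inv_apply(2)[OF g(1)] by simp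
      ultimately show "z \<in> g ` (\<lambda>g. g y) ` {g \<in> \<Gamma>. g a = a}" by blast
    qed
    then show ?thesis using fin finite_subset by blast
  next
    case False
    then have "r `` {x} = {}" by (auto simp: r_def)
    then show ?thesis by simp
  qed
  ultimately have "r \<subseteq> Id" by (rule locally_finite_invariant_trivial)
  moreover have "(a, y) \<in> r" using image_eqI[of "(a, y)" "\<lambda>g. (g a, g y)" id \<Gamma>] id_closed
    unfolding r_def by simp
  ultimately show False using \<open>y \<noteq> a\<close> by blast
qed


section \<open>The group contains every three-cycle of every orbit\<close>

text \<open>
  Separation in the stabilizer of \<open>a\<close> gives a conjugate of \<open>\<gamma>\<close> whose support meets that of \<open>\<gamma>\<close> in \<open>a\<close>
  alone; the commutator of the two is the desired three-cycle.
\<close>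

lemma three_cycle_through:
  assumes a: "a \<in> supp \<gamma>"
  shows "\<exists>b c. distinct [a, b, c] \<and> three_cycle a b c \<in> \<Gamma>"
proof -
  interpret stab: permutation_group \<Omega> "{g \<in> \<Gamma>. g a = a}" by (rule stabilizer)
  have suppO: "supp \<gamma> \<subseteq> \<Omega>"
    using permutes[OF gamma(1)] by (auto simp: supp_def permutes_def)
  let ?B = "supp \<gamma> - {a}"
  have "finite ?B" using gamma(2) by (simp add: finitary_def)
  moreover have "infinite (stab.orb b)" if "b \<in> ?B" for b
    using infinite_stabilizer_orbit[of a b] that a suppO by blast
  ultimately obtain h where h: "h \<in> \<Gamma>" "h a = a" "h ` ?B \<inter> ?B = {}"
    using stab.separation[of ?B ?B] by blast
  let ?k = "h \<circ> \<gamma> \<circ> inv_into UNIV h"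
  have k: "?k \<in> \<Gamma>" by (intro comp_closed inv_closed h(1) gamma(1))
  have supk: "supp ?k = h ` supp \<gamma>" using h(1) by (rule supp_conjugate)
  have "supp \<gamma> \<inter> h ` supp \<gamma> \<subseteq> {a}"
  proof (rule subsetI, rule ccontr)
    fix x assume x: "x \<in> supp \<gamma> \<inter> h ` supp \<gamma>" "x \<notin> {a}"
    then obtain y where y: "y \<in> supp \<gamma>" "x = h y" by blast
    with x(2) h(2) have "y \<in> ?B" by auto
    with x y have "x \<in> h ` ?B \<inter> ?B" by blast
    with h(3) show False by blast
  qed
  moreover have "a \<in> h ` supp \<gamma>" using image_eqI[of a h a] h(2) a by simp
  ultimately have int: "supp \<gamma> \<inter> supp ?k = {a}" using a unfolding supk by blast
  note comm = commutator_eq_three_cycle[OF bij[OF gamma(1)] bij[OF k] int]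
  have "\<gamma> \<circ> ?k \<circ> inv_into UNIV \<gamma> \<circ> inv_into UNIV ?k \<in> \<Gamma>"
    by (intro comp_closed inv_closed k gamma(1))
  with comm show ?thesis by auto
qed

lemma three_cycle_conjugate_closed:
  assumes g: "g \<in> \<Gamma>" and t: "three_cycle a b c \<in> \<Gamma>"
  shows "three_cycle (g a) (g b) (g c) \<in> \<Gamma>"
proof -
  have "g \<circ> three_cycle a b c \<circ> inv_into UNIV g \<in> \<Gamma>"
    by (intro comp_closed inv_closed g t)
  then show ?thesis unfolding three_cycle_conjugate[OF bij[OF g]] .
qed

lemma three_cycle_reverse_closed:
  assumes d: "distinct [a, b, c]" and t: "three_cycle a b c \<in> \<Gamma>"
  shows "three_cycle a c b \<in> \<Gamma>"
  unfolding inv_three_cycle[OF d, symmetric] using t by (rule inv_closed)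

lemma three_cycle_rotate_closed:
  assumes d: "distinct [a, b, c]" and t: "three_cycle a b c \<in> \<Gamma>"
  shows "three_cycle b c a \<in> \<Gamma>"
  using t by (simp only: three_cycle_rotate[OF d])

text \<open>
  Primitivity applies once "equal or consecutive on a three-cycle of \<open>\<Gamma>\<close>" is known to be an
  equivalence relation.  For transitivity, conjugating \<open>(u v z)\<close> by \<open>(v w t)\<close> turns \<open>v\<close> into \<open>w\<close> and
  keeps \<open>u\<close>, unless \<open>t = u\<close>, in which case the second cycle already contains \<open>u\<close> and \<open>w\<close>.
\<close>

lemma three_cycle_join:
  assumes x: "x \<in> \<Omega>" and y: "y \<in> orb x" "x \<noteq> y"
  shows "\<exists>z. distinct [x, y, z] \<and> three_cycle x y z \<in> \<Gamma>"
proof -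
  define r where "r = {(x, y). x \<in> \<Omega> \<and>
      (x = y \<or> (\<exists>z. distinct [x, y, z] \<and> three_cycle x y z \<in> \<Gamma>))}"
  have within: "v \<in> orb u" if "(u, v) \<in> r" for u v
  proof (cases "u = v")
    case False
    with that have "\<exists>z. distinct [u, v, z] \<and> three_cycle u v z \<in> \<Gamma>" by (simp add: r_def)
    then obtain z where z: "distinct [u, v, z]" "three_cycle u v z \<in> \<Gamma>" by blast
    have "v = three_cycle u v z u" unfolding three_cycle_apply[OF z(1)] by simp
    then show ?thesis using z(2) by (rule image_eqI)
  qed (use self_in_orb in blast)
  have rO: "r \<subseteq> \<Omega> \<times> \<Omega>"
  proof (rule subrelI)
    fix u v assume "(u, v) \<in> r"
    moreover from this have "u \<in> \<Omega>" by (simp add: r_def)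
    ultimately show "(u, v) \<in> \<Omega> \<times> \<Omega>" using within orb_subset_Omega by blast
  qed
  have inv: "invariant_rel r"
    unfolding invariant_rel_def
  proof (intro conjI ballI rO; clarify?)
    fix g u v assume g: "g \<in> \<Gamma>" and "(u, v) \<in> r"
    then have "u \<in> \<Omega>" and *: "u = v \<or> (\<exists>z. distinct [u, v, z] \<and> three_cycle u v z \<in> \<Gamma>)"
      by (auto simp: r_def)
    have inj: "g s = g t \<longleftrightarrow> s = t" for s t using bij[OF g] by (simp add: bij_is_inj inj_eq)
    have "g u = g v \<or> (\<exists>z. distinct [g u, g v, z] \<and> three_cycle (g u) (g v) z \<in> \<Gamma>)"
      using *
    proof (elim disjE exE conjE)
      fix z assume "distinct [u, v, z]" "three_cycle u v z \<in> \<Gamma>"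
      then have "distinct [g u, g v, g z] \<and> three_cycle (g u) (g v) (g z) \<in> \<Gamma>"
        using three_cycle_conjugate_closed[OF g] by (simp add: inj)
      then show ?thesis by blast
    qed simp
    then show "(g u, g v) \<in> r" using \<open>u \<in> \<Omega>\<close> g in_Omega_iff by (auto simp: r_def)
  qed
  have "trans r"
  proof (rule transI)
    fix u v w assume uv: "(u, v) \<in> r" and vw: "(v, w) \<in> r"
    show "(u, w) \<in> r"
    proof (cases "u = v \<or> v = w \<or> u = w")
      case True
      then show ?thesis using uv vw by (auto simp: r_def)
    next
      case False
      obtain z where z: "distinct [u, v, z]" "three_cycle u v z \<in> \<Gamma>"
        using uv False by (auto simp: r_def)
      obtain t where t: "distinct [v, w, t]" "three_cycle v w t \<in> \<Gamma>"
        using vw False by (auto simp: r_def)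
      have "\<exists>z. distinct [u, w, z] \<and> three_cycle u w z \<in> \<Gamma>"
      proof (cases "t = u")
        case True
        with t have "three_cycle w u v \<in> \<Gamma>" by - (rule three_cycle_rotate_closed, auto)
        then have "three_cycle u v w \<in> \<Gamma>"
          using False by - (rule three_cycle_rotate_closed, auto)
        then have "three_cycle u w v \<in> \<Gamma>"
          using False by - (rule three_cycle_reverse_closed, auto)
        with False show ?thesis by auto
      next
        case tu: False
        let ?g = "three_cycle v w t"
        have g: "?g u = u" "?g v = w" using t tu False by (auto simp: three_cycle_apply)
        have inj: "?g p = ?g q \<longleftrightarrow> p = q" for p q using bij[OF t(2)] by (simp add: bij_is_inj inj_eq)
        have "three_cycle u w (?g z) \<in> \<Gamma>"
          using three_cycle_conjugate_closed[OF t(2) z(2)] g by simp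
        moreover have "distinct [u, w, ?g z]" using z(1) g inj by (metis distinct_length_2_or_more distinct_singleton)
        ultimately show ?thesis by blast
      qed
      then show ?thesis using uv by (auto simp: r_def)
    qed
  qed
  moreover have "sym r"
  proof (rule symI)
    fix u v assume uv: "(u, v) \<in> r"
    then have "v \<in> \<Omega>" using rO by blast
    moreover have "\<exists>z. distinct [v, u, z] \<and> three_cycle v u z \<in> \<Gamma>" if "u \<noteq> v"
    proof -
      obtain z where z: "distinct [u, v, z]" "three_cycle u v z \<in> \<Gamma>"
        using uv \<open>u \<noteq> v\<close> by (auto simp: r_def)
      then have "three_cycle v z u \<in> \<Gamma>" by (rule three_cycle_rotate_closed)
      then have "three_cycle v u z \<in> \<Gamma>" using z(1) by - (rule three_cycle_reverse_closed, auto)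
      with z(1) show ?thesis by auto
    qed
    ultimately show "(v, u) \<in> r" by (auto simp: r_def)
  qed
  moreover have "refl_on \<Omega> r" by (auto simp: refl_on_def r_def)
  ultimately have equiv: "equiv \<Omega> r" using rO by (intro equivI)
  obtain a where a: "a \<in> supp \<gamma>" "a \<in> orb x" using gamma_meets[OF x] by blast
  obtain b c where bc: "distinct [a, b, c]" "three_cycle a b c \<in> \<Gamma>"
    using three_cycle_through[OF a(1)] by blast
  have "a \<in> \<Omega>" using a(2) x orb_subset_Omega by blast
  then have "(a, b) \<in> r" "a \<noteq> b" using bc by (auto simp: r_def)
  then have all: "(a, w) \<in> r" if "w \<in> orb x" for w
    using primitive_within_orbits[OF equiv inv within] that orb_eq[OF a(2)] by blast
  have "(a, x) \<in> r" "(a, y) \<in> r" using all self_in_orb y by blast+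
  then have "(x, y) \<in> r" using equiv by (meson equiv_def symE transE)
  with y show ?thesis by (auto simp: r_def)
qed

text \<open>
  Conjugating \<open>(p q r)\<close> by \<open>(p s r)\<close> gives \<open>(s q p)\<close>, the inverse of \<open>(p q s)\<close>.
\<close>

lemma three_cycle_exchange:
  assumes "distinct [p, q, r, s]" and "three_cycle p q r \<in> \<Gamma>" and "three_cycle p s r \<in> \<Gamma>"
  shows "three_cycle p q s \<in> \<Gamma>"
proof -
  have "three_cycle s q p \<in> \<Gamma>"
    using three_cycle_conjugate_closed[OF assms(3,2)] assms(1) by (auto simp: three_cycle_apply)
  then have "three_cycle q p s \<in> \<Gamma>"
    using assms(1) by - (rule three_cycle_rotate_closed, auto)
  then have "three_cycle p s q \<in> \<Gamma>"
    using assms(1) by - (rule three_cycle_rotate_closed, auto)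
  then show ?thesis
    using assms(1) by - (rule three_cycle_reverse_closed, auto)
qed

text \<open>
  Start from three-cycles \<open>(x y z)\<close> and \<open>(x w v)\<close>.  If they share a second point, the exchange lemma or
  an inversion suffices.  Otherwise, conjugating the first by the second gives \<open>(w y z)\<close>, which shares
  the two points \<open>y\<close> and \<open>z\<close> with the first, and the exchange lemma applies to these two.
\<close>

proposition three_cycles_of_orbit:
  assumes x: "x \<in> \<Omega>" and y: "y \<in> orb x" and w: "w \<in> orb x" and d: "distinct [x, y, w]"
  shows "three_cycle x y w \<in> \<Gamma>"
proof -
  obtain z where z: "distinct [x, y, z]" "three_cycle x y z \<in> \<Gamma>"
    using three_cycle_join[OF x y] d by auto
  obtain v where v: "distinct [x, w, v]" "three_cycle x w v \<in> \<Gamma>"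
    using three_cycle_join[OF x w] d by auto
  consider "z = w" | "v = y" | "z \<noteq> w" "v = z" | "z \<noteq> w" "v \<noteq> y" "v \<noteq> z" by blast
  then show ?thesis
  proof cases
    case 1
    with z show ?thesis by simp
  next
    case 2
    with v show ?thesis using three_cycle_reverse_closed by blast
  next
    case 3
    with z v d show ?thesis by - (rule three_cycle_exchange[of x y z w], auto)
  next
    case 4
    have "three_cycle w y z \<in> \<Gamma>"
      using three_cycle_conjugate_closed[OF v(2) z(2)] 4 z v d by (auto simp: three_cycle_apply)
    then have "three_cycle y z w \<in> \<Gamma>"
      using z d 4 by - (rule three_cycle_rotate_closed, auto)
    then have ywz: "three_cycle y w z \<in> \<Gamma>"
      using z d 4 by - (rule three_cycle_reverse_closed, auto)
    have "three_cycle y z x \<in> \<Gamma>"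
      using z by (rule three_cycle_rotate_closed)
    then have "three_cycle y x z \<in> \<Gamma>"
      using z(1) by - (rule three_cycle_reverse_closed, auto)
    with ywz have "three_cycle y x w \<in> \<Gamma>"
      using z d 4 by - (rule three_cycle_exchange[of y x z w], auto)
    then have "three_cycle x w y \<in> \<Gamma>"
      using d by - (rule three_cycle_rotate_closed, auto)
    then show ?thesis
      using d by - (rule three_cycle_reverse_closed, auto)
  qed
qed

theorem alternating_group_of_orbit_subset:
  assumes x: "x \<in> \<Omega>"
  shows "carrier (alternating_group (orb x)) \<subseteq> \<Gamma>"
proof
  fix p assume "p \<in> carrier (alternating_group (orb x))"
  then have p: "p permutes orb x" "finitary p" "evenperm p"
    by (auto simp: carrier_alternating_group)
  show "p \<in> \<Gamma>"
  proof (rule even_finitary_in_three_cycle_closure[OF p id_closed comp_closed])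
    fix a b c assume "a \<in> orb x" "b \<in> orb x" "c \<in> orb x" "distinct [a, b, c]"
    moreover from this have "orb a = orb x" "a \<in> \<Omega>"
      using orb_eq orb_subset_Omega[OF x] by blast+
    ultimately show "three_cycle a b c \<in> \<Gamma>" by (intro three_cycles_of_orbit) auto
  qed
qed

end


section \<open>From the orbits to the direct sum\<close>

text \<open>
  An element of the direct sum is the product of its components, one for each index; the induction
  multiplies them together one at a time.
\<close>

lemma (in permutation_group) alternating_direct_sum_subset:
  assumes "finite I" and disj: "disjoint_family_on X I"
    and alt: "\<And>i. i \<in> I \<Longrightarrow> carrier (alternating_group (X i)) \<subseteq> \<Gamma>"
  shows "alternating_direct_sum I X \<subseteq> \<Gamma>"
proof
  fix g assume "g \<in> alternating_direct_sum I X"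
  then obtain x where g: "g permutes (\<Union>i\<in>I. X i)"
    and x: "x \<in> carrier (sum_group I (\<lambda>i. alternating_group (X i)))"
    and gx: "\<And>i w. i \<in> I \<Longrightarrow> w \<in> X i \<Longrightarrow> g w = x i w"
    unfolding alternating_direct_sum_def by auto
  have xi: "x i \<in> carrier (alternating_group (X i))" if "i \<in> I" for i
    using x that by (auto simp: carrier_sum_group group_alternating_group PiE_iff)
  then have perm: "x i permutes X i" if "i \<in> I" for i
    using that by (auto simp: carrier_alternating_group)
  have "(\<lambda>w. if w \<in> (\<Union>i\<in>J. X i) then g w else w) \<in> \<Gamma>" if "finite J" "J \<subseteq> I" for J
    using that
  proof (induction J)
    case empty
    show ?case using id_closed by (simp add: id_def)
  next
    case (insert j J)
    let ?f = "\<lambda>w. if w \<in> (\<Union>i\<in>J. X i) then g w else w"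
    have j: "j \<in> I" using insert by blast
    have apart: "w \<notin> (\<Union>i\<in>J. X i)" if "w \<in> X j" for w
      using that insert disj by (fastforce simp: disjoint_family_on_def)
    have "x j \<circ> ?f = (\<lambda>w. if w \<in> (\<Union>i\<in>insert j J. X i) then g w else w)"
    proof
      fix w
      consider "w \<in> X j" | "w \<in> (\<Union>i\<in>J. X i)" | "w \<notin> X j" "w \<notin> (\<Union>i\<in>J. X i)" by blast
      then show "(x j \<circ> ?f) w = (if w \<in> (\<Union>i\<in>insert j J. X i) then g w else w)"
      proof cases
        case 1
        then show ?thesis using apart gx j by simp
      next
        case 2
        then obtain i where i: "i \<in> J" "w \<in> X i" by blast
        with insert have iI: "i \<in> I" by blast
        then have "g w \<in> X i" using gx i perm by (simp add: permutes_in_image)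
        with i apart have "g w \<notin> X j" by blast
        then have "x j (g w) = g w" using perm[OF j] by (rule permutes_not_in[rotated])
        then show ?thesis using 2 by simp
      next
        case 3
        then show ?thesis using permutes_not_in[OF perm[OF j]] by simp
      qed
    qed
    moreover have "x j \<circ> ?f \<in> \<Gamma>"
      using insert xi alt j by (intro comp_closed) auto
    ultimately show ?case by simp
  qed
  from this[OF \<open>finite I\<close> order_refl]
  have "(\<lambda>w. if w \<in> (\<Union>i\<in>I. X i) then g w else w) \<in> \<Gamma>" .
  moreover have "(\<lambda>w. if w \<in> (\<Union>i\<in>I. X i) then g w else w) = g"
    using permutes_not_in[OF g] by (auto simp: fun_eq_iff)
  ultimately show "g \<in> \<Gamma>" by simp
qed

text \<open>
  The classes of an invariant equivalence relation form an invariant partition, so primitivity may be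
  used in the form that \<^locale>\<open>primitive_finitary_group\<close> requires.
\<close>

lemma (in permutation_group) strongly_orbit_primitive_classes:
  assumes prim: "strongly_orbit_primitive ((symmetric_group \<Omega>)\<lparr>carrier := \<Gamma>\<rparr>) \<Omega> (\<lambda>g. g)"
    and equiv: "equiv \<Omega> r" and inv: "invariant_rel r" and x: "x \<in> \<Omega>"
  shows "r `` {x} = {x} \<or> (\<exists>y\<in>\<Omega>. orb y \<subseteq> r `` {x})"
proof -
  let ?G = "(symmetric_group \<Omega>)\<lparr>carrier := \<Gamma>\<rparr>"
  have image: "g ` (r `` {u}) = r `` {g u}" if g: "g \<in> \<Gamma>" for g u
  proof (rule subset_antisym; rule subsetI)
    fix z assume "z \<in> r `` {g u}"
    then have "(g u, g (inv_into UNIV g z)) \<in> r" using g by (simp add: inv_apply)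
    then have "(u, inv_into UNIV g z) \<in> r" using invariant_relD[OF inv g] by blast
    then show "z \<in> g ` (r `` {u})" using inv_apply(2)[OF g, of z] by force
  qed (use invariant_relD[OF inv g] in auto)
  have "partition_on \<Omega> (\<Omega> // r)"
    using equiv by (rule partition_on_quotient)
  moreover have "g ` P \<in> \<Omega> // r" if "P \<in> \<Omega> // r" "g \<in> \<Gamma>" for P g
  proof -
    obtain u where "u \<in> \<Omega>" "P = r `` {u}" using \<open>P \<in> \<Omega> // r\<close> by (rule quotientE)
    then show ?thesis using image that(2) in_Omega_iff by (simp add: quotientI)
  qed
  ultimately have "invariant_partition ?G \<Omega> (\<lambda>g. g) (\<Omega> // r)"
    by (simp add: invariant_partition_def)
  moreover have "r `` {x} \<in> \<Omega> // r" using x by (rule quotientI)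
  ultimately have "is_singleton (r `` {x}) \<or> (\<exists>B\<in>orbits ?G \<Omega> (\<lambda>g. g). B \<subseteq> r `` {x})"
    using prim unfolding strongly_orbit_primitive_def by blast
  then show ?thesis
  proof
    assume "is_singleton (r `` {x})"
    moreover have "x \<in> r `` {x}" using equiv x by (rule equiv_class_self)
    ultimately show ?thesis by (metis is_singleton_def singletonD)
  next
    assume "\<exists>B\<in>orbits ?G \<Omega> (\<lambda>g. g). B \<subseteq> r `` {x}"
    then show ?thesis by (simp add: orbits_eq)
  qed
qed

theorem theorem8p4:
  fixes \<Omega> :: "'a set"
    and \<Gamma> :: "('a \<Rightarrow> 'a) set"
    and k :: nat
    and \<Omega>s :: "nat \<Rightarrow> 'a set"
  assumes "infinite \<Omega>"
    and "subgroup \<Gamma> (symmetric_group \<Omega>)"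
    and "orbits ((symmetric_group \<Omega>)\<lparr>carrier := \<Gamma>\<rparr>) \<Omega> (\<lambda>g. g) = \<Omega>s ` {1..k}"
    and "inj_on \<Omega>s {1..k}"
    and "\<And>i. i \<in> {1..k} \<Longrightarrow> infinite (\<Omega>s i)"
    and "(\<Union>i\<in>{1..k}. \<Omega>s i) = \<Omega>"
    and "\<exists>\<gamma>\<in>\<Gamma>. finitary \<gamma> \<and> (\<forall>i\<in>{1..k}. supp \<gamma> \<inter> \<Omega>s i \<noteq> {})"
    and "strongly_orbit_primitive ((symmetric_group \<Omega>)\<lparr>carrier := \<Gamma>\<rparr>) \<Omega> (\<lambda>g. g)"
  shows "subgroup (alternating_direct_sum {1..k} \<Omega>s) ((symmetric_group \<Omega>)\<lparr>carrier := \<Gamma>\<rparr>)"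
proof -
  interpret permutation_group \<Omega> \<Gamma> by (rule permutation_group.intro) (rule assms(2))
  have orbits: "orb ` \<Omega> = \<Omega>s ` {1..k}"
    using assms(3) by (simp add: orbits_eq)
  obtain \<gamma> where \<gamma>: "\<gamma> \<in> \<Gamma>" "finitary \<gamma>" "\<And>i. i \<in> {1..k} \<Longrightarrow> supp \<gamma> \<inter> \<Omega>s i \<noteq> {}"
    using assms(7) by blast
  have orb_index: "\<exists>i\<in>{1..k}. orb x = \<Omega>s i" if "x \<in> \<Omega>" for x
  proof -
    have "orb x \<in> \<Omega>s ` {1..k}"
      using imageI[OF that, of "\<lambda>x. orb x"] unfolding orbits .
    then show ?thesis by (simp only: image_iff)
  qed
  interpret primitive_finitary_group \<Omega> \<Gamma> \<gamma>
  proof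
    show "finite (orb ` \<Omega>)" by (simp add: orbits)
    show "infinite (orb x)" if "x \<in> \<Omega>" for x
      using orb_index[OF that] assms(5) by metis
    show "supp \<gamma> \<inter> orb x \<noteq> {}" if "x \<in> \<Omega>" for x
      using orb_index[OF that] \<gamma>(3) by metis
    show "r `` {x} = {x} \<or> (\<exists>y\<in>\<Omega>. orb y \<subseteq> r `` {x})"
      if "equiv \<Omega> r" "invariant_rel r" "x \<in> \<Omega>" for r x
      using strongly_orbit_primitive_classes[OF assms(8) that] .
  qed (rule \<gamma>)+
  have index_orb: "\<exists>x\<in>\<Omega>. \<Omega>s i = orb x" if "i \<in> {1..k}" for i
  proof -
    have "\<Omega>s i \<in> orb ` \<Omega>"
      using imageI[OF that, of \<Omega>s] unfolding orbits .
    then show ?thesis by (simp only: image_iff)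
  qed
  have "disjoint_family_on \<Omega>s {1..k}"
    unfolding disjoint_family_on_def
  proof (intro ballI impI)
    fix i j assume ij: "i \<in> {1..k}" "j \<in> {1..k}" "i \<noteq> j"
    then have "\<Omega>s i \<noteq> \<Omega>s j" using assms(4) by (meson inj_onD)
    moreover obtain x y where "\<Omega>s i = orb x" "\<Omega>s j = orb y" using index_orb ij by metis
    ultimately show "\<Omega>s i \<inter> \<Omega>s j = {}" using orb_eq by (metis disjoint_iff)
  qed
  moreover have "carrier (alternating_group (\<Omega>s i)) \<subseteq> \<Gamma>" if "i \<in> {1..k}" for i
    using index_orb[OF that] alternating_group_of_orbit_subset by metis
  ultimately have "alternating_direct_sum {1..k} \<Omega>s \<subseteq> \<Gamma>"
    by (intro alternating_direct_sum_subset) auto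
  moreover have "subgroup (alternating_direct_sum {1..k} \<Omega>s) (symmetric_group \<Omega>)"
    using subgroup_alternating_direct_sum[of "{1..k}" \<Omega>s] assms(6) by simp
  ultimately show ?thesis
    using group.subgroup_incl[OF group_symmetric_group _ assms(2)] by blast
qed

end
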